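(* Let $0<p<1$, $q=1-p$, let $X\sim\operatorname{Bin}(N,p)$, $\nu=\lceil Np\rceil$, and suppose $1\le\nu\le N-1$. Then $$2\nu q\,e^{\,M_N+\varepsilon_N^{-}}\le\mathbb E|X-Np|\le2\nu q\,e^{\,M_N+\varepsilon_N^{+}},$$ where $$M_N=\tfrac12\log\frac{N}{2\pi\nu(N-\nu)}+\nu\log\frac{Np}{\nu}+(N-\nu)\log\frac{Nq}{N-\nu},$$ $$\varepsilon_N^{+}=\frac1{12N}-\frac1{12\nu+1}-\frac1{12(N-\nu)+1},\qquad \varepsilon_N^{-}=\frac1{12N+1}-\frac1{12\nu}-\frac1{12(N-\nu)}.$$ Moreover the logarithmic gap between the two bounds satisfies $$\varepsilon_N^{+}-\varepsilon_N^{-}=\Bigl(\frac1{12N}-\frac1{12N+1}\Bigr)+\Bigl(\frac1{12\nu}-\frac1{12\nu+1}\Bigr)+\Bigl(\frac1{12(N-\nu)}-\frac1{12(N-\nu)+1}\Bigr)<\frac1{144}\Bigl(\frac1{N^2}+\frac1{\nu^2}+\frac1{(N-\nu)^2}\Bigr).$$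
   Context: $\operatorname{Bin}(N,p)$ is the binomial distribution with $N$ trials and success probability $p$. *)

theory Defs
  imports "HOL-Probability.Probability"
begin

end

theory Submission
  imports Defs
begin

text \<open>
  Write \<open>b k\<close> for the binomial weights. Since \<open>(k + 1) q b (k + 1) = (N - k) p b k\<close>, the
  terms \<open>(k - N p) b k\<close> equal \<open>k q b k - (k + 1) q b (k + 1)\<close> and telescope; as the deviations have
  mean zero, the mean absolute deviation is twice the sum over \<open>k \<ge> \<nu>\<close>, that is, De Moivre's
  \<open>2 \<nu> q b \<nu>\<close>. Robbins' form of Stirling's formula, applied to the three factorials in \<open>b \<nu>\<close>,
  gives the bounds. Robbins' bounds in turn follow from estimates of the increments of the error
  in Stirling's formula by differences of \<open>1 / (12 n)\<close> and of \<open>1 / (12 n + 1)\<close>, because that error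
  tends to 0 by the Wallis product.
\<close>

section \<open>Increments of the error in Stirling's formula\<close>

definition stirling_error :: "nat \<Rightarrow> real" where
  "stirling_error n = ln (fact n) - ((real n + 1 / 2) * ln (real n) - real n + ln (2 * pi) / 2)"

lemma stirling_error_diff:
  assumes "n > 0"
  shows "stirling_error n - stirling_error (Suc n) = (real n + 1 / 2) * ln ((real n + 1) / real n) - 1"
proof -
  have "ln (fact (Suc n)) = ln (real n + 1) + ln (fact n :: real)"
    by (simp add: ln_mult add.commute)
  moreover have "ln ((real n + 1) / real n) = ln (real n + 1) - ln (real n)"
    using assms by (subst ln_div) auto
  hence "(real n + 1 / 2) * ln ((real n + 1) / real n) =
      (real n + 1 / 2) * ln (real n + 1) - (real n + 1 / 2) * ln (real n)"
    by (simp only: right_diff_distrib)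
  ultimately show ?thesis
    unfolding stirling_error_def of_nat_Suc by (simp add: algebra_simps del: fact_Suc)
qed

lemma stirling_error_diff_bounds:
  assumes "n > 0"
  shows "stirling_error n - stirling_error (Suc n) \<le> 1 / (12 * real n) - 1 / (12 * real (Suc n))"
    and "1 / (12 * real n + 1) - 1 / (12 * real (Suc n) + 1) \<le> stirling_error n - stirling_error (Suc n)"
proof -
  define x where "x = (real n + 1) / real n"
  define y where "y = 1 / (2 * real n + 1)"
  \<comment> \<open>\<open>ln x = 2 artanh y\<close>, so the difference is \<open>y\<^sup>2 / 3 + y\<^sup>4 / 5 + \<dots>\<close>; the first term alone
    gives the lower bound, and a geometric series the upper one.\<close>
  have n: "real n \<ge> 1" using assms by simp
  have y: "y > 0" using n by (simp add: y_def)
  have n_y: "real n + 1 / 2 = 1 / (2 * y)" using n by (simp add: y_def field_simps)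
  have x: "x > 1" using n by (simp add: x_def field_simps)
  have xy: "(x - 1) / (x + 1) = y" using n by (simp add: x_def y_def field_simps)
  have upper: "ln x \<le> 2 * y + 2 * (y ^ 3 / (1 - y\<^sup>2) / 3)"
    using ln_approx_bounds[OF x, of 1] unfolding xy by (simp add: eval_nat_numeral)
  have lower: "2 * y + 2 * y ^ 3 / 3 \<le> ln x"
    using ln_approx_bounds[OF x, of 2] unfolding xy by (simp add: eval_nat_numeral)
  have "(real n + 1 / 2) * ln x \<le> (real n + 1 / 2) * (2 * y + 2 * (y ^ 3 / (1 - y\<^sup>2) / 3))"
    using n upper by (intro mult_left_mono) auto
  also have "\<dots> = 1 + y\<^sup>2 / (1 - y\<^sup>2) / 3"
    unfolding n_y using y by (simp add: field_simps eval_nat_numeral)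
  also have "y\<^sup>2 / (1 - y\<^sup>2) = 1 / ((2 * real n + 1)\<^sup>2 - 1)"
  proof -
    have "(2 * real n + 1)\<^sup>2 > 1" using n by simp
    thus ?thesis unfolding y_def by (simp add: field_simps)
  qed
  \<comment> \<open>Since \<open>(2n + 1)^2 - 1 = 4n(n + 1)\<close>, the geometric estimate is
    \<open>1 / (12n(n + 1))\<close>, which splits into partial fractions.\<close>
  also have "1 / ((2 * real n + 1)\<^sup>2 - 1) / 3 = 1 / (12 * real n) - 1 / (12 * real (Suc n))"
    using n by (simp add: field_simps power2_eq_square)
  finally show "stirling_error n - stirling_error (Suc n) \<le> 1 / (12 * real n) - 1 / (12 * real (Suc n))"
    unfolding stirling_error_diff[OF assms] x_def by simp
  have "1 / (12 * real n + 1) - 1 / (12 * real (Suc n) + 1) = 12 / (144 * (real n)\<^sup>2 + 168 * real n + 13)"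
    using n by (simp add: field_simps power2_eq_square)
  \<comment> \<open>The denominators differ by \<open>24n - 23\<close>, which is positive precisely
    because \<open>n\<close> is at least 1.\<close>
  also have "\<dots> \<le> 12 / (36 * (2 * real n + 1)\<^sup>2)"
    using n by (intro divide_left_mono mult_pos_pos) (auto simp: power2_eq_square algebra_simps add_pos_pos)
  also have "\<dots> = (real n + 1 / 2) * (2 * y + 2 * y ^ 3 / 3) - 1"
  proof -
    have "(real n + 1 / 2) * (2 * y + 2 * y ^ 3 / 3) - 1 = y\<^sup>2 / 3"
      unfolding n_y using y by (simp add: field_simps eval_nat_numeral)
    thus ?thesis by (simp add: y_def power_divide)
  qed
  also have "\<dots> \<le> (real n + 1 / 2) * ln x - 1"
    using n lower by (intro diff_right_mono mult_left_mono) auto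
  finally show "1 / (12 * real n + 1) - 1 / (12 * real (Suc n) + 1) \<le> stirling_error n - stirling_error (Suc n)"
    unfolding stirling_error_diff[OF assms] x_def .
qed

text \<open>This and its increasing counterpart restate the increment bounds in monotone form, so
  that knowing the limit will bound every term. The shift by \<open>Suc\<close> starts the sequences
  at 1, where the increment bounds begin.\<close>

lemma stirling_error_decseq: "decseq (\<lambda>n. stirling_error (Suc n) - 1 / (12 * real (Suc n) + 1))"
  using stirling_error_diff_bounds(2)[of "Suc _"]
  by (intro decseq_SucI) (auto simp: algebra_simps)

lemma stirling_error_incseq: "incseq (\<lambda>n. stirling_error (Suc n) - 1 / (12 * real (Suc n)))"
  using stirling_error_diff_bounds(1)[of "Suc _"]
  by (intro incseq_SucI) (auto simp: algebra_simps)

section \<open>The Wallis product and the limit of the error\<close>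

text \<open>Each factor is \<open>(2k)(2k) / ((2k - 1)(2k + 1))\<close>. Completing the products of
  odd numbers to factorials leaves only \<open>n!\<close>, \<open>(2n)!\<close> and elementary
  terms, which makes the Wallis product comparable with Stirling's formula.\<close>

lemma ln_wallis_product:
  "ln (\<Prod>k=1..n. (4 * real k ^ 2) / (4 * real k ^ 2 - 1)) =
     4 * real n * ln 2 + 4 * ln (fact n) - 2 * ln (fact (2 * n)) - ln (2 * real n + 1)"
proof (induction n)
  case 0
  show ?case by simp
next
  case (Suc n)
  have pos: "(4 * real k ^ 2) / (4 * real k ^ 2 - 1) > 0" if "k \<ge> 1" for k
  proof -
    have "real k ^ 2 \<ge> 1" using that by simp
    thus ?thesis by (intro divide_pos_pos) linarith+
  qed
  have fact1: "ln (fact (Suc n)) = ln (real n + 1) + ln (fact n :: real)"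
    by (simp add: ln_mult add.commute)
  have gt_0: "0 < real n + 1" "0 < 2 * real n + 1" "0 < 2 * real (Suc n) + 1" by simp_all
  have "fact (2 * Suc n) = 2 * (real n + 1) * ((2 * real n + 1) * fact (2 * n))"
    by (simp add: algebra_simps)
  hence fact2: "ln (fact (2 * Suc n) :: real) = ln 2 + ln (real n + 1) + (ln (2 * real n + 1) + ln (fact (2 * n)))"
    by (simp only: ln_mult_pos mult_pos_pos gt_0 fact_gt_zero zero_less_numeral)
  have "(4 * real (Suc n) ^ 2) / (4 * real (Suc n) ^ 2 - 1)
      = (2 * (real n + 1)) * (2 * (real n + 1)) / ((2 * real n + 1) * (2 * real (Suc n) + 1))"
    by (simp add: power2_eq_square algebra_simps)
  also have "ln \<dots> = (ln 2 + ln (real n + 1)) + (ln 2 + ln (real n + 1)) - (ln (2 * real n + 1) + ln (2 * real (Suc n) + 1))"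
    by (simp only: ln_mult_pos ln_divide_pos mult_pos_pos gt_0 zero_less_numeral)
  finally have step: "ln ((4 * real (Suc n) ^ 2) / (4 * real (Suc n) ^ 2 - 1)) = \<dots>" .
  have "ln (\<Prod>k=1..Suc n. (4 * real k ^ 2) / (4 * real k ^ 2 - 1)) =
      ln (\<Prod>k=1..n. (4 * real k ^ 2) / (4 * real k ^ 2 - 1)) + ln ((4 * real (Suc n) ^ 2) / (4 * real (Suc n) ^ 2 - 1))"
    by (subst prod.nat_ivl_Suc', simp, subst ln_mult_pos)
      (use pos[of "Suc n"] pos in \<open>auto intro!: prod_pos simp: mult.commute add.commute\<close>)
  also have "\<dots> = 4 * real (Suc n) * ln 2 + 4 * ln (fact (Suc n)) - 2 * ln (fact (2 * Suc n)) - ln (2 * real (Suc n) + 1)"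
    unfolding Suc.IH step fact1 fact2 by (simp add: algebra_simps)
  finally show ?case .
qed

text \<open>In this combination the multiples of \<open>n ln n\<close> and of \<open>n\<close> in
  Stirling's main terms cancel, leaving \<open>ln (pi n) - 4 n ln 2\<close>; the powers of 2 cancel
  against those in the Wallis product.\<close>

lemma stirling_error_wallis:
  assumes "n > 0"
  shows "4 * stirling_error n - 2 * stirling_error (2 * n) =
    ln (\<Prod>k=1..n. (4 * real k ^ 2) / (4 * real k ^ 2 - 1)) - ln (pi * real n / (2 * real n + 1))"
  unfolding ln_wallis_product stirling_error_def using assms
  by (simp add: ln_mult ln_div algebra_simps)

text \<open>Monotonicity and boundedness yield some limit \<open>c\<close>. Passing to the limit
  along \<open>n\<close> and \<open>2 * n\<close> in the Wallis identity gives
  \<open>4 * c - 2 * c = 0\<close>; this is what singles out the constant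
  \<open>ln (2 * pi) / 2\<close>.\<close>

lemma stirling_error_tendsto_0: "stirling_error \<longlonglongrightarrow> 0"
proof -
  let ?lo = "\<lambda>n. stirling_error (Suc n) - 1 / (12 * real (Suc n))"
  let ?up = "\<lambda>n. stirling_error (Suc n) - 1 / (12 * real (Suc n) + 1)"
  \<comment> \<open>The increasing sequence stays below the decreasing one, hence below the first
    term of the latter.\<close>
  have "?lo n \<le> ?up 0" for n
  proof -
    have "?lo n \<le> ?up n" by (simp add: field_simps)
    also have "\<dots> \<le> ?up 0" using stirling_error_decseq by (auto dest: decseqD)
    finally show ?thesis .
  qed
  then obtain c where c: "?lo \<longlonglongrightarrow> c"
    using incseq_convergent[OF stirling_error_incseq] by metis
  have "(\<lambda>n. 1 / (12 * real (Suc n))) \<longlonglongrightarrow> 0" by real_asymp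
  from tendsto_add[OF c this] have "(\<lambda>n. stirling_error (Suc n)) \<longlonglongrightarrow> c" by simp
  hence lim: "stirling_error \<longlonglongrightarrow> c" by (rule LIMSEQ_imp_Suc)
  have "strict_mono (\<lambda>n::nat. 2 * n)" by (auto simp: strict_mono_def)
  from LIMSEQ_subseq_LIMSEQ[OF lim this]
  have "(\<lambda>n. 4 * stirling_error n - 2 * stirling_error (2 * n)) \<longlonglongrightarrow> 4 * c - 2 * c"
    by (intro tendsto_intros lim) (simp add: o_def)
  moreover have "(\<lambda>n. 4 * stirling_error n - 2 * stirling_error (2 * n)) \<longlonglongrightarrow> ln (pi / 2) - ln (pi / 2)"
  proof (rule Lim_transform_eventually)
    have "(\<lambda>n. pi * real n / (2 * real n + 1)) \<longlonglongrightarrow> pi / 2" by real_asymp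
    thus "(\<lambda>n. ln (\<Prod>k=1..n. (4 * real k ^ 2) / (4 * real k ^ 2 - 1)) - ln (pi * real n / (2 * real n + 1)))
        \<longlonglongrightarrow> ln (pi / 2) - ln (pi / 2)"
      by (intro tendsto_diff tendsto_ln wallis) auto
    show "\<forall>\<^sub>F n in sequentially.
        ln (\<Prod>k=1..n. (4 * real k ^ 2) / (4 * real k ^ 2 - 1)) - ln (pi * real n / (2 * real n + 1)) =
        4 * stirling_error n - 2 * stirling_error (2 * n)"
      using eventually_gt_at_top[of 0] by eventually_elim (simp add: stirling_error_wallis)
  qed
  ultimately have "4 * c - 2 * c = 0" using LIMSEQ_unique by fastforce
  with lim show ?thesis by simp
qed

text \<open>Both corrected sequences tend to 0; a decreasing one lies above its limit and an
  increasing one below.\<close>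

theorem robbins_bounds:
  assumes "n > 0"
  shows "1 / (12 * real n + 1) \<le> stirling_error n" and "stirling_error n \<le> 1 / (12 * real n)"
proof -
  obtain m where m: "n = Suc m" using assms by (cases n) auto
  note lim = LIMSEQ_Suc[OF stirling_error_tendsto_0]
  have "(\<lambda>n. 1 / (12 * real (Suc n) + 1)) \<longlonglongrightarrow> 0" by real_asymp
  from tendsto_diff[OF lim this] decseq_ge[OF stirling_error_decseq, of 0 m]
  show "1 / (12 * real n + 1) \<le> stirling_error n" by (simp add: m)
  have "(\<lambda>n. 1 / (12 * real (Suc n))) \<longlonglongrightarrow> 0" by real_asymp
  from tendsto_diff[OF lim this] incseq_le[OF stirling_error_incseq, of 0 m]
  show "stirling_error n \<le> 1 / (12 * real n)" by (simp add: m)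
qed

section \<open>Binomial weights and De Moivre's formula\<close>

text \<open>An exact identity, as the errors are kept. The linear terms of the three factorials
  cancel, and their half logarithms and constants combine into the square-root factor.\<close>

lemma binomial_weight_stirling:
  fixes p q :: real
  assumes "0 < k" "k < n" "0 < p" "0 < q"
  shows "real (n choose k) * p ^ k * q ^ (n - k) =
    exp (1 / 2 * ln (real n / (2 * pi * real k * (real n - real k)))
      + real k * ln (real n * p / real k)
      + (real n - real k) * ln (real n * q / (real n - real k))
      + (stirling_error n - stirling_error k - stirling_error (n - k)))"
    (is "_ = exp ?e")
proof -
  define l where "l = real n - real k"
  have l: "real (n - k) = l" "real n - real k = l" "l > 0" using assms by (auto simp: l_def)
  have "ln (real (n choose k) * p ^ k * q ^ (n - k)) =
      ln (fact n) - ln (fact k) - ln (fact (n - k)) + real k * ln p + real (n - k) * ln q"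
    using assms by (simp add: binomial_fact ln_mult ln_div ln_realpow)
  also have "\<dots> = ?e"
    unfolding stirling_error_def l(1,2) using assms l(3)
    by (simp add: ln_mult ln_div) (simp add: l_def field_simps)
  finally have "ln (real (n choose k) * p ^ k * q ^ (n - k)) = ?e" .
  moreover have "real (n choose k) * p ^ k * q ^ (n - k) > 0" using assms by simp
  ultimately show ?thesis by (metis exp_ln)
qed

lemma binomial_deviation_telescope:
  fixes p q :: real and n :: nat
  assumes "p + q = 1"
  defines "b \<equiv> \<lambda>k. real (n choose k) * p ^ k * q ^ (n - k)"
  assumes "k \<le> n"
  shows "(real k - real n * p) * b k = real k * q * b k - real (Suc k) * q * b (Suc k)"
proof -
  have "real (Suc k) * q * b (Suc k) = (real n - real k) * p * b k"
  \<comment> \<open>At \<open>k = n\<close> both sides vanish, as \<open>n choose Suc n\<close> is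
    0. This case is separate because the exponent \<open>n - Suc k\<close> is then
    truncated.\<close>
  proof (cases "k = n")
    case False
    hence k: "k < n" using assms by simp
    have "Suc k * (n choose Suc k) = (n - k) * (n choose k)"
      by (metis binomial_absorption binomial_absorb_comp)
    hence "real (Suc k) * real (n choose Suc k) = (real n - real k) * real (n choose k)"
      using k by (metis of_nat_diff of_nat_mult less_imp_le)
    moreover have "n - k = Suc (n - Suc k)" using k by simp
    ultimately show ?thesis by (simp add: b_def del: of_nat_Suc)
  qed (simp add: b_def)
  moreover have "q = 1 - p" using assms by simp
  ultimately show ?thesis by (simp only:) (simp add: algebra_simps)
qed

lemma binomial_mean_abs_deviation:
  fixes p q :: real and n :: nat
  assumes pq: "p + q = 1" and \<nu>: "int \<nu> = \<lceil>real n * p\<rceil>" "\<nu> \<le> n"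
  defines "b \<equiv> \<lambda>k. real (n choose k) * p ^ k * q ^ (n - k)"
  shows "(\<Sum>k\<le>n. \<bar>real k - real n * p\<bar> * b k) = 2 * real \<nu> * q * b \<nu>"
proof -
  have tail: "(\<Sum>k=m..n. (real k - real n * p) * b k) = real m * q * b m" if "m \<le> n" for m
  proof -
    have "(\<Sum>k=m..n. (real k - real n * p) * b k) =
        (\<Sum>k=m..n. real k * q * b k - real (Suc k) * q * b (Suc k))"
      unfolding b_def using pq by (intro sum.cong refl binomial_deviation_telescope) auto
    also have "\<dots> = real m * q * b m - real (Suc n) * q * b (Suc n)"
      using that sum_Suc_diff[of m n "\<lambda>k. - (real k * q * b k)"] by simp
    also have "b (Suc n) = 0" by (simp add: b_def)
    finally show ?thesis by simp
  qed
  \<comment> \<open>This is \<open>|t| = 2 max(t, 0) - t\<close>: by the choice of \<nu> as a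
    ceiling, \<open>t\<close> is nonnegative exactly from \<nu> on.\<close>
  have sign: "\<bar>real k - real n * p\<bar> = (if \<nu> \<le> k then 2 * (real k - real n * p) else 0) - (real k - real n * p)" for k
  proof (cases "\<nu> \<le> k")
    case True
    hence "real n * p \<le> real k" using \<nu>(1) by linarith
    thus ?thesis using True by simp
  next
    case False
    hence "real k < real n * p" using \<nu>(1) by linarith
    thus ?thesis using False by simp
  qed
  have "(\<Sum>k\<le>n. \<bar>real k - real n * p\<bar> * b k) =
      (\<Sum>k\<le>n. if \<nu> \<le> k then 2 * ((real k - real n * p) * b k) else 0) - (\<Sum>k\<le>n. (real k - real n * p) * b k)"
    unfolding sign sum_subtractf[symmetric] by (intro sum.cong) (auto simp: algebra_simps)
  \<comment> \<open>The mean deviation is the tail from 0, whose closed form carries the factor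
    0.\<close>
  also have "(\<Sum>k\<le>n. (real k - real n * p) * b k) = 0"
    using tail[of 0] by (simp add: atLeast0AtMost)
  also have "(\<Sum>k\<le>n. if \<nu> \<le> k then 2 * ((real k - real n * p) * b k) else 0) =
      (\<Sum>k=\<nu>..n. 2 * ((real k - real n * p) * b k))"
    by (intro sum.mono_neutral_cong_right) auto
  also have "\<dots> = 2 * real \<nu> * q * b \<nu>"
    using tail[OF \<nu>(2)] by (simp flip: sum_distrib_left)
  finally show ?thesis by simp
qed

text \<open>With \<open>y = 12 * x\<close> this is \<open>1 / (y(y + 1)) < 1 / y^2\<close>; each of
  the three brackets in the gap has this form.\<close>

lemma inverse_gap_less:
  fixes x :: real
  assumes "x > 0"
  shows "1 / (12 * x) - 1 / (12 * x + 1) < 1 / 144 * (1 / x\<^sup>2)"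
proof -
  have "1 / (12 * x) - 1 / (12 * x + 1) = 1 / (12 * x * (12 * x + 1))"
    using assms by (simp add: field_simps)
  also have "\<dots> < 1 / (144 * x\<^sup>2)"
    using assms by (intro divide_strict_left_mono mult_pos_pos) (auto simp: power2_eq_square algebra_simps)
  finally show ?thesis by simp
qed

theorem proposition5p1:
  fixes \<Omega> :: "'a measure" and X :: "'a \<Rightarrow> nat" and N \<nu> :: nat
    and p q M \<epsilon>p \<epsilon>m :: real
  assumes "0 < p" and "p < 1" and "q = 1 - p"
    and "prob_space \<Omega>"
    and "X \<in> measurable \<Omega> (count_space UNIV)"
    and "distr \<Omega> (count_space UNIV) X = measure_pmf (binomial_pmf N p)"
    and "int \<nu> = \<lceil>real N * p\<rceil>"
    and "1 \<le> \<nu>" and "\<nu> \<le> N - 1"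
    and "M = 1 / 2 * ln (real N / (2 * pi * real \<nu> * (real N - real \<nu>)))
             + real \<nu> * ln (real N * p / real \<nu>)
             + (real N - real \<nu>) * ln (real N * q / (real N - real \<nu>))"
    and "\<epsilon>p = 1 / (12 * real N) - 1 / (12 * real \<nu> + 1)
             - 1 / (12 * (real N - real \<nu>) + 1)"
    and "\<epsilon>m = 1 / (12 * real N + 1) - 1 / (12 * real \<nu>)
             - 1 / (12 * (real N - real \<nu>))"
  shows "2 * real \<nu> * q * exp (M + \<epsilon>m)
           \<le> prob_space.expectation \<Omega> (\<lambda>\<omega>. \<bar>real (X \<omega>) - real N * p\<bar>)
       \<and> prob_space.expectation \<Omega> (\<lambda>\<omega>. \<bar>real (X \<omega>) - real N * p\<bar>)
           \<le> 2 * real \<nu> * q * exp (M + \<epsilon>p)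
       \<and> \<epsilon>p - \<epsilon>m = (1 / (12 * real N) - 1 / (12 * real N + 1))
             + (1 / (12 * real \<nu>) - 1 / (12 * real \<nu> + 1))
             + (1 / (12 * (real N - real \<nu>)) - 1 / (12 * (real N - real \<nu>) + 1))
       \<and> (1 / (12 * real N) - 1 / (12 * real N + 1))
             + (1 / (12 * real \<nu>) - 1 / (12 * real \<nu> + 1))
             + (1 / (12 * (real N - real \<nu>)) - 1 / (12 * (real N - real \<nu>) + 1))
           < 1 / 144 * (1 / (real N)\<^sup>2 + 1 / (real \<nu>)\<^sup>2 + 1 / (real N - real \<nu>)\<^sup>2)"
proof -
  let ?E = "prob_space.expectation \<Omega> (\<lambda>\<omega>. \<bar>real (X \<omega>) - real N * p\<bar>)"
  have \<nu>: "0 < \<nu>" "\<nu> < N" using assms by auto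
  have r: "real (N - \<nu>) = real N - real \<nu>" using \<nu> by simp
  have q: "0 < q" "p + q = 1" using assms by auto
  have "?E = (\<integral>k. \<bar>real k - real N * p\<bar> \<partial>distr \<Omega> (count_space UNIV) X)"
    using assms(5) by (subst integral_distr) auto
  also have "\<dots> = (\<Sum>k\<le>N. \<bar>real k - real N * p\<bar> * (real (N choose k) * p ^ k * q ^ (N - k)))"
    unfolding assms(6) using assms(1-3)
    by (subst integral_measure_pmf[of "{..N}"]) (auto simp: mult_ac)
  also have "\<dots> = 2 * real \<nu> * q * (real (N choose \<nu>) * p ^ \<nu> * q ^ (N - \<nu>))"
    using binomial_mean_abs_deviation[OF q(2) assms(7)] \<nu> by simp
  also have "real (N choose \<nu>) * p ^ \<nu> * q ^ (N - \<nu>) =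
      exp (M + (stirling_error N - stirling_error \<nu> - stirling_error (N - \<nu>)))"
    unfolding assms(10) by (rule binomial_weight_stirling) (use assms \<nu> q in auto)
  finally have E: "?E = 2 * real \<nu> * q *
      exp (M + (stirling_error N - stirling_error \<nu> - stirling_error (N - \<nu>)))" .
  \<comment> \<open>The errors at \<nu> and \<open>N - \<nu>\<close> enter with a minus sign, so
    each side uses one Robbins bound for \<open>N\<close> and the opposite one for these
    two.\<close>
  have bounds: "\<epsilon>m \<le> stirling_error N - stirling_error \<nu> - stirling_error (N - \<nu>)"
    "stirling_error N - stirling_error \<nu> - stirling_error (N - \<nu>) \<le> \<epsilon>p"
    using robbins_bounds[of N] robbins_bounds[of \<nu>] robbins_bounds[of "N - \<nu>"] \<nu>
    unfolding assms(11,12) r by auto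
  have "2 * real \<nu> * q * exp (M + \<epsilon>m) \<le> ?E" "?E \<le> 2 * real \<nu> * q * exp (M + \<epsilon>p)"
    unfolding E using bounds q by (intro mult_left_mono; simp)+
  moreover have "\<epsilon>p - \<epsilon>m = (1 / (12 * real N) - 1 / (12 * real N + 1))
             + (1 / (12 * real \<nu>) - 1 / (12 * real \<nu> + 1))
             + (1 / (12 * (real N - real \<nu>)) - 1 / (12 * (real N - real \<nu>) + 1))"
    unfolding assms(11,12) by simp
  ultimately show ?thesis
    using inverse_gap_less[of "real N"] inverse_gap_less[of "real \<nu>"]
      inverse_gap_less[of "real N - real \<nu>"] \<nu>
    unfolding distrib_left by (intro conjI) auto
qed

end
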